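(* Any finite graph (possibly with hanging edges) can be topologically embedded into the book $\mathbb Y=T\times I$, where $T$ is the cone on three points and $I\approx[0,1]$.
   Context: A finite graph is a finite 1-dimensional CW-complex (self-loops, multiple edges and several components are allowed). A hanging edge is an edge having an endpoint of degree 1. *)

theory Defs
  imports "HOL-Analysis.Analysis"
begin

(* A finite CW structure of dimension at most 1 on the Hausdorff space X: the 0-cells are
   the points of V, and each e in E is a 1-cell with characteristic map \<phi> e on the closed
   1-disc [0,1]. Since there are finitely many cells and X is Hausdorff, V is discrete and
   closure finiteness and the weak topology are automatic. Nothing restricts \<phi> e 0
   and \<phi> e 1 within V, so loops, parallel edges, hanging edges and several components are
   allowed. E may be empty, and V may contain isolated vertices. *)
definition finite_graph ::
  "'a topology \<Rightarrow> 'a set \<Rightarrow> 'e set \<Rightarrow> ('e \<Rightarrow> real \<Rightarrow> 'a) \<Rightarrow> bool"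
where
  "finite_graph X V E \<phi> \<longleftrightarrow>
     Hausdorff_space X \<and> finite V \<and> finite E \<and>
     (\<forall>e\<in>E. continuous_map (top_of_set {0..1}) X (\<phi> e) \<and>
            \<phi> e 0 \<in> V \<and> \<phi> e 1 \<in> V \<and>
            embedding_map (top_of_set {0<..<1}) X (\<phi> e)) \<and>
     disjoint_family_on (\<lambda>e. \<phi> e ` {0<..<1}) E \<and>
     (\<forall>e\<in>E. V \<inter> \<phi> e ` {0<..<1} = {}) \<and>
     topspace X = V \<union> (\<Union>e\<in>E. \<phi> e ` {0<..<1})"

(* The points of the cone over X are the apex None and the Some (x, t) with
   x in X and 0 <= t < 1; the map below collapses the end t = 1 of X \<times> [0,1]. *)
definition cone_proj :: "'a \<times> real \<Rightarrow> ('a \<times> real) option" where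
  "cone_proj p = (if snd p = 1 then None else Some p)"

(* X \<times> [0,1] / X \<times> {1} with the quotient topology; the apex is inserted explicitly so
   that the cone over the empty space is a point. *)
definition cone_topology :: "'a topology \<Rightarrow> ('a \<times> real) option topology" where
  "cone_topology X = topology (\<lambda>U.
     U \<subseteq> insert None (cone_proj ` (topspace X \<times> {0..1})) \<and>
     openin (prod_topology X (top_of_set {0..1}))
       {p \<in> topspace X \<times> {0..1}. cone_proj p \<in> U})"

lemma openin_cone_topology:
  "openin (cone_topology X) U \<longleftrightarrow>
     U \<subseteq> insert None (cone_proj ` (topspace X \<times> {0..1})) \<and>
     openin (prod_topology X (top_of_set {0..1}))
       {p \<in> topspace X \<times> {0..1}. cone_proj p \<in> U}"
proof -
  let ?P = "prod_topology X (top_of_set {0..1::real})"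
  let ?pre = "\<lambda>U. {p \<in> topspace X \<times> {0..1}. cone_proj p \<in> U}"
  have "istopology (\<lambda>U. U \<subseteq> insert None (cone_proj ` (topspace X \<times> {0..1})) \<and>
      openin ?P (?pre U))"
    unfolding istopology_def
  proof (intro conjI allI impI, goal_cases)
    case (2 S T)
    have "?pre (S \<inter> T) = ?pre S \<inter> ?pre T" by auto
    moreover have "openin ?P (?pre S \<inter> ?pre T)" using 2 by (intro openin_Int) blast+
    ultimately show ?case by metis
  next
    case (4 \<K>)
    have "?pre (\<Union>\<K>) = \<Union> (?pre ` \<K>)" by auto
    moreover have "openin ?P (\<Union> (?pre ` \<K>))" using 4 by (intro openin_Union) auto
    ultimately show ?case by simp
  qed auto
  then show ?thesis unfolding cone_topology_def by simp
qed

lemma topspace_cone_topology: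
  "topspace (cone_topology X) = insert None (cone_proj ` (topspace X \<times> {0..1}))"
proof -
  let ?C = "insert None (cone_proj ` (topspace X \<times> {0..1}))"
  have "{p \<in> topspace X \<times> {0..1}. cone_proj p \<in> ?C}
      = topspace (prod_topology X (top_of_set {0..1}))" by auto
  then have "openin (cone_topology X) ?C"
    unfolding openin_cone_topology by (metis openin_topspace subset_refl)
  then have "?C \<subseteq> topspace (cone_topology X)" by (rule openin_subset)
  moreover have "topspace (cone_topology X) \<subseteq> ?C"
    using openin_topspace[of "cone_topology X"] unfolding openin_cone_topology by (rule conjunct1)
  ultimately show ?thesis by (rule subset_antisym[rotated])
qed

lemma quotient_map_cone_proj:
  assumes "topspace X \<noteq> {}"
  shows "quotient_map (prod_topology X (top_of_set {0..1})) (cone_topology X) cone_proj"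
proof -
  obtain x where "x \<in> topspace X" using assms by blast
  then have "(x, 1) \<in> topspace X \<times> {0..1::real}" "cone_proj (x, 1) = None"
    by (auto simp: cone_proj_def)
  then have "None \<in> cone_proj ` (topspace X \<times> {0..1})" by (metis image_eqI)
  then show ?thesis
    unfolding quotient_map_def
    by (auto simp: topspace_cone_topology openin_cone_topology insert_absorb)
qed

definition three_points :: "nat topology" where
  "three_points = discrete_topology {0, 1, 2}"

definition book :: "((nat \<times> real) option \<times> real) topology" where
  "book = prod_topology (cone_topology three_points) (top_of_set {0..1})"

end

theory Submission
  imports Defs
begin

text \<open>
  Two pages of the book form a plane; the third is a half-plane attached along the real axis of
  that plane. Put the vertices at points \<open>0, 1, \<dots>, n - 1\<close> of the axis and let two curves
  start from the ends of every edge, each running along its own Archimedean spiral in the plane,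
  with all spirals pairwise disjoint away from the vertices. Every half-turn brings each spiral back
  to the axis, so the two spirals of the \<open>j\<close>-th edge can be stopped at their \<open>j\<close>-th crossing and
  joined by an arc in the third page. The arcs of distinct edges lie over disjoint intervals of the
  axis, hence nothing intersects. Compactness of the graph turns this continuous injection into an
  embedding.
\<close>

section \<open>Coordinates on the book\<close>

text \<open>Legs 1 and 2 of the cone point in opposite directions, so times the interval they form a
  flat strip; leg 0 gives the third page, perpendicular to it.\<close>

definition page_vec :: "nat \<Rightarrow> real \<times> real" where
  "page_vec i = (if i = 0 then (0, 1) else if i = 1 then (1, 0) else (- 1, 0))"

definition cone_coord :: "(nat \<times> real) option \<Rightarrow> real \<times> real" where
  "cone_coord p = (case p of None \<Rightarrow> 0 | Some (i, t) \<Rightarrow> (1 - t) *\<^sub>R page_vec i)"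

definition book_coord :: "(nat \<times> real) option \<times> real \<Rightarrow> (real \<times> real) \<times> real" where
  "book_coord = (\<lambda>(p, t). (cone_coord p, t))"

lemma cone_coord_cone_proj: "cone_coord (cone_proj (i, t)) = (1 - t) *\<^sub>R page_vec i"
  by (simp add: cone_coord_def cone_proj_def)

lemma topspace_three_points [simp]: "topspace three_points = {0, 1, 2}"
  by (simp add: three_points_def)

lemma three_points_eq_top_of_set: "three_points = top_of_set {0, 1, 2}"
  by (rule topology_eq[THEN iffD2])
    (auto simp: three_points_def openin_subtopology open_discrete)

lemma continuous_map_cone_coord:
  "continuous_map (cone_topology three_points) euclidean cone_coord"
proof (rule continuous_compose_quotient_map[OF quotient_map_cone_proj])
  have "cone_coord \<circ> cone_proj = (\<lambda>x. (1 - snd x) *\<^sub>R page_vec (fst x))"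
    by (auto simp: cone_coord_cone_proj)
  moreover have "continuous_on UNIV page_vec"
    by (simp add: continuous_on_open_vimage open_discrete)
  then have "continuous_on ({0, 1, 2} \<times> {0..1}) (\<lambda>x. (1 - snd x) *\<^sub>R page_vec (fst x))"
    by (intro continuous_on_scaleR continuous_on_diff continuous_on_const continuous_on_snd
        continuous_on_id continuous_on_compose2[of UNIV page_vec, OF _ continuous_on_fst])
      simp_all
  ultimately show "continuous_map (prod_topology three_points (top_of_set {0..1})) euclidean
      (cone_coord \<circ> cone_proj)"
    unfolding three_points_eq_top_of_set prod_topology_subtopology_eu
    by simp
qed simp

lemma inj_on_cone_coord: "inj_on cone_coord (topspace (cone_topology three_points))"
  by (rule inj_onI)
    (auto simp: topspace_cone_topology cone_coord_def cone_proj_def page_vec_def zero_prod_def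
      split: if_splits)

lemma continuous_map_book_coord: "continuous_map book euclidean book_coord"
proof -
  have "continuous_map book (prod_topology euclidean euclidean) book_coord"
    unfolding book_def book_coord_def continuous_map_prod_top
    by (simp add: continuous_map_cone_coord)
  then show ?thesis
    by (simp flip: euclidean_product_topology)
qed

lemma inj_on_book_coord: "inj_on book_coord (topspace book)"
  using inj_on_cone_coord by (auto simp: inj_on_def book_def book_coord_def)

lemma compact_space_book: "compact_space book"
proof -
  have "compact_space (prod_topology three_points (top_of_set {0..1::real}))"
    by (simp add: compact_space_prod_topology three_points_def compact_space_discrete_topology compact_space_subtopology)
  then have "compact_space (cone_topology three_points)"
    using quotient_map_cone_proj[of three_points]
    by (metis compact_space_def image_compactin insert_not_empty quotient_imp_continuous_map
        quotient_imp_surjective_map topspace_three_points)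
  then show ?thesis
    by (simp add: book_def compact_space_prod_topology compact_space_subtopology)
qed

lemma embedding_map_book_coord: "embedding_map book euclidean book_coord"
  by (intro injective_closed_imp_embedding_map continuous_imp_closed_map
      continuous_map_book_coord inj_on_book_coord compact_space_book Hausdorff_space_euclidean)

text \<open>Concrete model of the book: \<open>a\<close> measures across the flat strip,
  \<open>r\<close> is the height in the third page, and \<open>t\<close> runs along the spine
  \<open>a = r = 0\<close>.\<close>

lemma book_coord_image_iff:
  "((a, r), t) \<in> book_coord ` topspace book \<longleftrightarrow>
     \<bar>a\<bar> \<le> 1 \<and> 0 \<le> r \<and> r \<le> 1 \<and> (a = 0 \<or> r = 0) \<and> 0 \<le> t \<and> t \<le> 1" (is "_ \<longleftrightarrow> ?R")
proof
  assume "((a, r), t) \<in> book_coord ` topspace book"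
  then show ?R
    by (auto simp: book_def book_coord_def topspace_cone_topology cone_coord_cone_proj
        page_vec_def split: if_splits) (auto simp: cone_coord_def zero_prod_def)
next
  assume R: ?R
  \<comment> \<open>At most one of \<open>a\<close>, \<open>r\<close> is nonzero, so
    \<open>\<bar>a\<bar> + r\<close> is the distance from the apex, which sits at cone parameter
    1.\<close>
  define i where "i = (if r > 0 then 0 else if a > 0 then 1 else 2 :: nat)"
  have "((a, r), t) = book_coord (cone_proj (i, 1 - (\<bar>a\<bar> + r)), t)"
    using R by (auto simp: book_coord_def cone_coord_cone_proj i_def page_vec_def)
  moreover have "(cone_proj (i, 1 - (\<bar>a\<bar> + r)), t) \<in> topspace book"
    using R by (auto simp: book_def topspace_cone_topology i_def)
  ultimately show "((a, r), t) \<in> book_coord ` topspace book"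
    by blast
qed

lemma embedding_map_into_book:
  assumes "embedding_map X euclidean F" "F ` topspace X \<subseteq> book_coord ` topspace book"
  shows "\<exists>f. embedding_map X book f"
proof -
  have "homeomorphic_map book (top_of_set (book_coord ` topspace book)) book_coord"
    using embedding_map_book_coord by (simp add: embedding_map_def)
  then obtain h where "homeomorphic_map (top_of_set (book_coord ` topspace book)) book h"
    by (metis homeomorphic_map_maps homeomorphic_maps_sym)
  then have "embedding_map (top_of_set (book_coord ` topspace book)) book h"
    using homeomorphic_imp_surjective_map unfolding embedding_map_def
    by (metis subtopology_topspace)
  moreover have "embedding_map X (top_of_set (book_coord ` topspace book)) F"
    using assms unfolding embedding_map_in_subtopology by (rule conjI)
  ultimately show ?thesis
    by (intro exI) (rule embedding_map_compose)
qed

section \<open>Maps defined on a finite graph\<close>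

lemma compact_space_finite_graph:
  assumes "finite_graph X V E \<phi>"
  shows "compact_space X"
proof -
  have V: "finite V" and E: "finite E" and XVE: "topspace X = V \<union> (\<Union>e\<in>E. \<phi> e ` {0<..<1})"
    and cont: "\<And>e. e \<in> E \<Longrightarrow> continuous_map (top_of_set {0..1}) X (\<phi> e)"
    using assms by (auto simp: finite_graph_def)
  have cpt: "compactin X (\<phi> e ` {0..1})" if "e \<in> E" for e
    using image_compactin[OF _ cont[OF that], of "{0..1}"] by (simp add: compactin_subtopology)
  then have "compactin X (V \<union> \<Union> ((\<lambda>e. \<phi> e ` {0..1}) ` E))"
    using V E XVE by (intro compactin_Un[OF finite_imp_compactin compactin_Union]) auto
  moreover have "V \<union> \<Union> ((\<lambda>e. \<phi> e ` {0..1}) ` E) = topspace X"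
  proof
    show "V \<union> \<Union> ((\<lambda>e. \<phi> e ` {0..1}) ` E) \<subseteq> topspace X"
      using compactin_subset_topspace[OF cpt] XVE by blast
    show "topspace X \<subseteq> V \<union> \<Union> ((\<lambda>e. \<phi> e ` {0..1}) ` E)"
      unfolding XVE by (intro Un_mono UN_mono image_mono) auto
  qed
  ultimately show ?thesis
    by (simp add: compact_space_def)
qed

text \<open>The preimage of a closed set consists of finitely many vertices and finitely many
  images, under the maps \<open>\<phi> e\<close>, of closed subsets of [0,1]. These maps are closed
  because [0,1] is compact and \<open>X\<close> is Hausdorff.\<close>

lemma continuous_map_finite_graph:
  assumes G: "finite_graph X V E \<phi>"
    and Y: "F \<in> topspace X \<rightarrow> topspace Y"
    and F: "\<And>e. e \<in> E \<Longrightarrow> continuous_map (top_of_set {0..1}) Y (F \<circ> \<phi> e)"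
  shows "continuous_map X Y F"
  unfolding continuous_map_closedin
proof (intro conjI allI impI)
  fix C assume C: "closedin Y C"
  have X: "Hausdorff_space X" and V: "finite V" and E: "finite E"
    and XVE: "topspace X = V \<union> (\<Union>e\<in>E. \<phi> e ` {0<..<1})"
    and cont: "\<And>e. e \<in> E \<Longrightarrow> continuous_map (top_of_set {0..1}) X (\<phi> e)"
    using G by (auto simp: finite_graph_def)
  let ?P = "\<lambda>e. {t \<in> topspace (top_of_set {0..1}). (F \<circ> \<phi> e) t \<in> C}"
  have P: "closedin X (\<phi> e ` ?P e)" if "e \<in> E" for e
  proof -
    have "closedin (top_of_set {0..1}) (?P e)"
      using F[OF that] C unfolding continuous_map_closedin by blast
    moreover have "closed_map (top_of_set {0..1}) X (\<phi> e)"
      using continuous_imp_closed_map[OF cont[OF that] _ X] by (simp add: compact_space_subtopology)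
    ultimately show ?thesis
      unfolding closed_map_def by blast
  qed
  have "closedin X ({v \<in> V. F v \<in> C} \<union> (\<Union>e\<in>E. \<phi> e ` ?P e))"
    using P E V XVE
    by (intro closedin_Un[OF closedin_Hausdorff_finite[OF X] closedin_Union]) auto
  moreover have "{x \<in> topspace X. F x \<in> C} = {v \<in> V. F v \<in> C} \<union> (\<Union>e\<in>E. \<phi> e ` ?P e)"
    (is "?A = ?B")
  proof
    show "?A \<subseteq> ?B"
      unfolding XVE by (auto simp: less_imp_le)
    have "\<phi> e t \<in> topspace X" if "e \<in> E" "t \<in> {0..1}" for e t
      using continuous_map_funspace[OF cont[OF that(1)]] that(2) by auto
    then show "?B \<subseteq> ?A"
      using XVE by auto
  qed
  ultimately show "closedin X {x \<in> topspace X. F x \<in> C}"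
    by simp
qed (fact Y)

text \<open>Reduces embedding a graph to drawing disjoint arcs: the pasted map is a continuous
  injection from a compact space into a Hausdorff space. Its image is recorded so that the drawing
  can later be confined to the book.\<close>

lemma embedding_map_finite_graph:
  fixes p :: "'a \<Rightarrow> 'b" and \<gamma> :: "'e \<Rightarrow> real \<Rightarrow> 'b"
  assumes G: "finite_graph X V E \<phi>"
    and Y: "Hausdorff_space Y"
    and p: "p \<in> V \<rightarrow> topspace Y" "inj_on p V"
    and \<gamma>: "\<And>e. e \<in> E \<Longrightarrow> continuous_map (top_of_set {0..1}) Y (\<gamma> e)"
    and ends: "\<And>e. e \<in> E \<Longrightarrow> \<gamma> e 0 = p (\<phi> e 0)" "\<And>e. e \<in> E \<Longrightarrow> \<gamma> e 1 = p (\<phi> e 1)"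
    and inj: "\<And>e e' t t'. e \<in> E \<Longrightarrow> e' \<in> E \<Longrightarrow> t \<in> {0<..<1} \<Longrightarrow> t' \<in> {0<..<1}
      \<Longrightarrow> \<gamma> e t = \<gamma> e' t' \<Longrightarrow> e = e' \<and> t = t'"
    and avoid: "\<And>e t v. e \<in> E \<Longrightarrow> t \<in> {0<..<1} \<Longrightarrow> v \<in> V \<Longrightarrow> \<gamma> e t \<noteq> p v"
  obtains F where "embedding_map X Y F"
    "F ` topspace X = p ` V \<union> (\<Union>e\<in>E. \<gamma> e ` {0<..<1})"
proof -
  have XVE: "topspace X = V \<union> (\<Union>e\<in>E. \<phi> e ` {0<..<1})"
    and \<phi>V: "\<And>e. e \<in> E \<Longrightarrow> \<phi> e 0 \<in> V" "\<And>e. e \<in> E \<Longrightarrow> \<phi> e 1 \<in> V"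
    and emb: "\<And>e. e \<in> E \<Longrightarrow> embedding_map (top_of_set {0<..<1}) X (\<phi> e)"
    and disj: "disjoint_family_on (\<lambda>e. \<phi> e ` {0<..<1}) E"
    and disjV: "\<And>e. e \<in> E \<Longrightarrow> V \<inter> \<phi> e ` {0<..<1} = {}"
    using G unfolding finite_graph_def by blast+
  have inj\<phi>: "e = e' \<and> t = t'"
    if "e \<in> E" "e' \<in> E" "t \<in> {0<..<1}" "t' \<in> {0<..<1}" "\<phi> e t = \<phi> e' t'" for e e' t t'
  proof -
    have "e = e'"
      using disj that unfolding disjoint_family_on_def by blast
    moreover have "inj_on (\<phi> e) {0<..<1}"
      using emb[OF \<open>e \<in> E\<close>] by (auto simp: embedding_map_def dest: homeomorphic_imp_injective_map)
    ultimately show ?thesis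
      using that by (auto dest: inj_onD)
  qed
  define F where "F x = (if x \<in> V then p x
    else THE y. \<exists>e\<in>E. \<exists>t\<in>{0<..<1}. x = \<phi> e t \<and> y = \<gamma> e t)" for x
  have FV: "F v = p v" if "v \<in> V" for v
    using that by (simp add: F_def)
  have FE: "F (\<phi> e t) = \<gamma> e t" if "e \<in> E" "t \<in> {0<..<1}" for e t
  proof -
    have "(THE y. \<exists>e'\<in>E. \<exists>t'\<in>{0<..<1}. \<phi> e t = \<phi> e' t' \<and> y = \<gamma> e' t') = \<gamma> e t"
      using that inj\<phi> by (intro the_equality) blast+
    moreover have "\<phi> e t \<notin> V"
      using disjV that by blast
    ultimately show ?thesis
      by (simp add: F_def)
  qed
  \<comment> \<open>At 0 and 1 the map \<open>F\<close> takes its value from a vertex;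
    \<open>ends\<close> makes it agree with the curve, so \<open>F\<close> inherits continuity on
    the closed edge.\<close>
  have F\<phi>: "(F \<circ> \<phi> e) t = \<gamma> e t" if e: "e \<in> E" and t: "t \<in> {0..1}" for e t
  proof -
    consider "t = 0" | "t = 1" | "t \<in> {0<..<1}"
      using t by force
    then show ?thesis
      using e by cases (simp_all add: FE FV \<phi>V ends)
  qed
  have image: "F ` topspace X = p ` V \<union> (\<Union>e\<in>E. \<gamma> e ` {0<..<1})"
    unfolding XVE image_Un image_UN by (simp add: FV FE image_image)
  have "continuous_map X Y F"
  proof (rule continuous_map_finite_graph[OF G])
    have "\<gamma> e t \<in> topspace Y" if "e \<in> E" "t \<in> {0<..<1}" for e t
      using continuous_map_funspace[OF \<gamma>[OF that(1)]] that(2) by auto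
    then show "F \<in> topspace X \<rightarrow> topspace Y"
      using p(1) unfolding image_subset_iff_funcset[symmetric] image by auto
    show "continuous_map (top_of_set {0..1}) Y (F \<circ> \<phi> e)" if "e \<in> E" for e
      using F\<phi>[OF that] by (intro continuous_map_eq[OF \<gamma>[OF that]]) auto
  qed
  moreover have "inj_on F (topspace X)"
  proof (rule inj_onI)
    fix x y assume xy: "x \<in> topspace X" "y \<in> topspace X" "F x = F y"
    have cases: "z \<in> V \<or> (\<exists>e\<in>E. \<exists>t\<in>{0<..<1}. z = \<phi> e t)" if "z \<in> topspace X" for z
      using that XVE by auto
    show "x = y"
      using cases[OF xy(1)] cases[OF xy(2)]
    proof (elim disjE bexE)
      assume "x \<in> V" "y \<in> V"
      then show ?thesis using xy(3) p(2) by (auto simp: FV dest: inj_onD)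
    next
      fix e t assume "x \<in> V" "e \<in> E" "t \<in> {0<..<1}" "y = \<phi> e t"
      then show ?thesis using xy(3) avoid by (metis FV FE)
    next
      fix e t assume "y \<in> V" "e \<in> E" "t \<in> {0<..<1}" "x = \<phi> e t"
      then show ?thesis using xy(3) avoid by (metis FV FE)
    next
      fix e t e' t'
      assume "e \<in> E" "t \<in> {0<..<1}" "x = \<phi> e t" "e' \<in> E" "t' \<in> {0<..<1}" "y = \<phi> e' t'"
      then show ?thesis using xy(3) inj by (metis FE)
    qed
  qed
  ultimately have "embedding_map X Y F"
    by (intro injective_closed_imp_embedding_map continuous_imp_closed_map
        compact_space_finite_graph[OF G] Y)
  then show thesis
    using image by (rule that)
qed

section \<open>Drawing the edges along spirals\<close>

text \<open>An Archimedean spiral with \<open>s\<close> counting half-turns: it starts at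
  \<open>x\<close> on the real axis, meets the axis at every integer \<open>s\<close> and gains
  \<open>n\<close> in radius per half-turn.\<close>

definition spiral :: "nat \<Rightarrow> real \<Rightarrow> real \<Rightarrow> complex" where
  "spiral n x s = (x + real n * s) *\<^sub>R cis (pi * s)"

text \<open>Equal points have equal radii and, away from the origin, angles equal up to full turns,
  so \<open>s - t = 2 * i\<close>. Then \<open>y - x = 2 * n * i\<close>, while offsets in
  \<open>[0, n)\<close> differ by less than \<open>n\<close>; hence \<open>i = 0\<close>.\<close>

lemma spiral_inject:
  assumes x: "0 \<le> x" "x < real n" "0 \<le> s" and y: "0 \<le> y" "y < real n" "0 \<le> t"
    and eq: "spiral n x s = spiral n y t"
  shows "x = y \<and> s = t"
proof -
  have "cmod (spiral n x s) = x + n * s" "cmod (spiral n y t) = y + n * t"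
    using x y by (simp_all add: spiral_def)
  with eq have r: "x + n * s = y + n * t"
    by simp
  show ?thesis
  proof (cases "x + n * s = 0")
    case True
    then show ?thesis
      using x y r by (auto simp: add_nonneg_eq_0_iff)
  next
    case False
    then have "cis (pi * s) = cis (pi * t)"
      using eq r by (simp add: spiral_def)
    then have "sin (pi * s) = sin (pi * t) \<and> cos (pi * s) = cos (pi * t)"
      by (simp add: complex_eq_iff)
    then obtain i :: int where "pi * s = pi * t + 2 * pi * i"
      unfolding sin_cos_eq_iff by blast
    then have "pi * s = pi * (t + 2 * i)"
      by (simp add: algebra_simps)
    then have s: "s = t + 2 * i"
      by simp
    have "y - x = n * (2 * i)"
      using r s by (simp add: algebra_simps)
    then have "\<bar>n * (2 * i)\<bar> < real n"
      using x y by linarith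
    then have "real n * \<bar>2 * real_of_int i\<bar> < real n * 1"
      by (simp add: abs_mult)
    then have "\<bar>2 * real_of_int i\<bar> < 1"
      using x by (simp only: mult_less_cancel_left_pos)
    then have "i = 0"
      by linarith
    then show ?thesis
      using r s by simp
  qed
qed

text \<open>The edge number \<open>j\<close> follows the spiral with offset \<open>u + s / (2 * j + 1)\<close> outwards until
  \<open>s = j\<close> and the one with offset \<open>v + s / (2 * j + 2)\<close> inwards. The denominators differ for all
  edge ends and exceed \<open>j\<close>, so the offset determines both the vertex, as its integer part, and the
  edge end. In each third of the unit interval only one of \<open>turn\<close>, \<open>bridge\<close> varies.\<close>

definition turn :: "nat \<Rightarrow> real \<Rightarrow> real" where
  "turn j t = real j * min 1 (min (3 * t) (3 - 3 * t))"

definition bridge :: "real \<Rightarrow> real" where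
  "bridge t = max 0 (min 1 (3 * t - 1))"

definition offset :: "nat \<Rightarrow> nat \<Rightarrow> nat \<Rightarrow> real \<Rightarrow> real" where
  "offset j u v t = (1 - bridge t) * (real u + turn j t / (2 * real j + 1))
     + bridge t * (real v + turn j t / (2 * real j + 2))"

text \<open>The second component, the height in the third page, is positive exactly while
  \<open>bridge\<close> is strictly between 0 and 1; this is the arc joining the two
  spirals.\<close>

definition edge_curve :: "nat \<Rightarrow> nat \<Rightarrow> nat \<Rightarrow> nat \<Rightarrow> real \<Rightarrow> complex \<times> real" where
  "edge_curve n j u v t =
     (spiral n (offset j u v t) (turn j t), bridge t * (1 - bridge t))"

lemma nat_add_frac_inject:
  fixes a b :: real
  assumes "real u + a = real v + b" "0 \<le> a" "a < 1" "0 \<le> b" "b < 1"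
  shows "u = v \<and> a = b"
proof -
  have "real u < real v + 1" "real v < real u + 1"
    using assms by linarith+
  then have "u = v"
    by linarith
  moreover from this have "a = b"
    using assms(1) by simp
  ultimately show ?thesis
    by simp
qed

lemma turn_bounds:
  assumes "t \<in> {0..1}"
  shows "0 \<le> turn j t" "turn j t \<le> real j"
  using assms by (auto simp: turn_def mult_left_le)

lemma turn_pos: "0 < j \<Longrightarrow> t \<in> {0<..<1} \<Longrightarrow> 0 < turn j t"
  by (simp add: turn_def)

lemma bridge_bounds: "0 \<le> bridge t" "bridge t \<le> 1"
  by (simp_all add: bridge_def)

lemma turn_on_bridge: "bridge t \<noteq> 0 \<Longrightarrow> bridge t \<noteq> 1 \<Longrightarrow> turn j t = real j"
  by (auto simp: turn_def bridge_def min_def max_def split: if_splits)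

text \<open>On the outer thirds \<open>turn\<close> is strictly monotone and \<open>bridge\<close>
  is 0 or 1, which tells them apart; on the middle third \<open>bridge\<close> is strictly
  monotone.\<close>

lemma turn_bridge_inject:
  assumes "0 < j" "turn j t = turn j t'" "bridge t = bridge t'" "t \<in> {0..1}" "t' \<in> {0..1}"
  shows "t = t'"
  using assms by (auto simp: turn_def bridge_def min_def max_def split: if_splits)

lemma frac_bounds:
  assumes "0 \<le> s" "s \<le> real j" "1 \<le> c"
  shows "0 \<le> s / (2 * real j + c)" "s / (2 * real j + c) < 1"
  using assms by (auto simp: divide_simps)

text \<open>A vertex number is at most \<open>n - 1\<close> and the added fraction is below 1, so
  both end offsets lie in \<open>[0, n)\<close>, as do their convex combinations.\<close>

lemma offset_bounds:
  assumes "u < n" "v < n" "t \<in> {0..1}"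
  shows "0 \<le> offset j u v t" "offset j u v t < real n"
proof -
  let ?a = "real u + turn j t / (2 * real j + 1)" and ?b = "real v + turn j t / (2 * real j + 2)"
  have ab: "0 \<le> ?a" "0 \<le> ?b" "?a < real n" "?b < real n"
    using assms frac_bounds[OF turn_bounds[OF assms(3), of j], of 1]
      frac_bounds[OF turn_bounds[OF assms(3), of j], of 2]
    by linarith+
  then show "0 \<le> offset j u v t"
    using bridge_bounds[of t] by (simp add: offset_def)
  show "offset j u v t < real n"
    unfolding offset_def
    using bridge_bounds[of t] ab by (intro convex_bound_lt) auto
qed

lemma continuous_on_edge_curve: "continuous_on A (edge_curve n j u v)"
  unfolding edge_curve_def spiral_def offset_def turn_def bridge_def
  by (intro continuous_intros) auto

lemma edge_curve_ends:
  "edge_curve n j u v 0 = (of_nat u, 0)" "edge_curve n j u v 1 = (of_nat v, 0)"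
  by (simp_all add: edge_curve_def spiral_def offset_def turn_def bridge_def
      scaleR_conv_of_real)

text \<open>The curve leaves the plane only where \<open>turn\<close> equals the integer
  \<open>j\<close>, and there the spiral lies on the real axis, along which the third page is
  attached.\<close>

lemma edge_curve_pages:
  "snd (edge_curve n j u v t) \<in> {0..1}"
  "Im (fst (edge_curve n j u v t)) = 0 \<or> snd (edge_curve n j u v t) = 0"
proof -
  show "snd (edge_curve n j u v t) \<in> {0..1}"
    using bridge_bounds[of t] by (simp add: edge_curve_def mult_le_one)
  show "Im (fst (edge_curve n j u v t)) = 0 \<or> snd (edge_curve n j u v t) = 0"
  proof (cases "bridge t = 0 \<or> bridge t = 1")
    case False
    then show ?thesis
      by (simp add: edge_curve_def spiral_def turn_on_bridge sin_npi2)
  qed (auto simp: edge_curve_def)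
qed

lemma norm_edge_curve_le:
  assumes "u < n" "v < n" "t \<in> {0..1}"
  shows "cmod (fst (edge_curve n j u v t)) \<le> real n + real n * real j"
proof -
  have "cmod (fst (edge_curve n j u v t)) = offset j u v t + real n * turn j t"
    using offset_bounds[OF assms] turn_bounds[OF assms(3)] by (simp add: edge_curve_def spiral_def)
  also have "\<dots> \<le> real n + real n * real j"
    using offset_bounds[OF assms, of j] turn_bounds[OF assms(3), of j]
    by (intro add_mono mult_left_mono) auto
  finally show ?thesis .
qed

text \<open>Vertex \<open>k\<close> is the start of the spiral with offset \<open>k\<close>, so a
  meeting would force \<open>turn\<close> to vanish.\<close>

lemma edge_curve_avoids_vertices:
  assumes "0 < j" "u < n" "v < n" "k < n" "t \<in> {0<..<1}"
  shows "edge_curve n j u v t \<noteq> (of_nat k, 0)"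
proof
  assume "edge_curve n j u v t = (of_nat k, 0)"
  then have "spiral n (offset j u v t) (turn j t) = spiral n (real k) 0"
    by (simp add: edge_curve_def spiral_def scaleR_conv_of_real)
  moreover have "t \<in> {0..1}"
    using assms by simp
  ultimately have "turn j t = 0"
    using spiral_inject[OF offset_bounds[of u n v t j] turn_bounds(1)[of t j], of "real k" 0] assms
    by simp
  then show False
    using turn_pos[of j t] assms by simp
qed

text \<open>Treats both spirals of an edge at once: \<open>b = 1\<close> is the one leaving
  \<open>u\<close>, \<open>b = 2\<close> the one arriving at \<open>v\<close>.\<close>

lemma offset_off_bridge:
  assumes "bridge t = 0 \<or> bridge t = 1"
  obtains w :: nat and b :: nat where "b \<in> {1, 2}" "bridge t = real b - 1"
    "offset j u v t = real w + turn j t / real (2 * j + b)"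
proof (cases "bridge t = 0")
  case True
  then show ?thesis by (intro that[of 1 u]) (auto simp: offset_def)
next
  case False
  then show ?thesis using assms by (intro that[of 2 v]) (auto simp: offset_def)
qed

text \<open>Equality in the plane gives equal \<open>offset\<close> and \<open>turn\<close>. On the
  spirals, the denominator in the offset reveals \<open>j\<close> and \<open>bridge\<close>; on the
  arcs, \<open>turn\<close> is \<open>j\<close> and the interpolated offset reveals
  \<open>bridge\<close>. Then \<open>turn\<close> and \<open>bridge\<close> fix the
  parameter.\<close>

lemma edge_curve_inject:
  assumes j: "0 < j" "0 < j'" and uv: "u < n" "v < n" "u' < n" "v' < n"
    and same: "j = j' \<Longrightarrow> u = u' \<and> v = v'"
    and t: "t \<in> {0<..<1}" "t' \<in> {0<..<1}"
    and eq: "edge_curve n j u v t = edge_curve n j' u' v' t'"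
  shows "j = j' \<and> t = t'"
proof -
  have t01: "t \<in> {0..1}" "t' \<in> {0..1}"
    using t by auto
  have "spiral n (offset j u v t) (turn j t) = spiral n (offset j' u' v' t') (turn j' t')"
    and page: "bridge t * (1 - bridge t) = bridge t' * (1 - bridge t')"
    using eq by (simp_all add: edge_curve_def)
  then have off: "offset j u v t = offset j' u' v' t'" and turn: "turn j t = turn j' t'"
    using spiral_inject offset_bounds[OF uv(1,2) t01(1)] offset_bounds[OF uv(3,4) t01(2)]
      turn_bounds t01 by metis+
  have "j = j' \<and> bridge t = bridge t'"
  proof (cases "bridge t = 0 \<or> bridge t = 1")
    case True
    \<comment> \<open>The height vanishes exactly when \<open>bridge\<close> is 0 or 1, so both
      points lie on spirals or both on arcs.\<close>
    then have True': "bridge t' = 0 \<or> bridge t' = 1"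
      using page by auto
    obtain w b where wb: "b \<in> {1, 2}" "bridge t = real b - 1"
      "offset j u v t = real w + turn j t / real (2 * j + b)"
      using offset_off_bridge[OF True] .
    obtain w' b' where wb': "b' \<in> {1, 2}" "bridge t' = real b' - 1"
      "offset j' u' v' t' = real w' + turn j' t' / real (2 * j' + b')"
      using offset_off_bridge[OF True'] .
    have "1 \<le> real b" "1 \<le> real b'"
      using wb(1) wb'(1) by auto
    then have "turn j t / real (2 * j + b) = turn j' t' / real (2 * j' + b')"
      using nat_add_frac_inject[of w "turn j t / real (2 * j + b)" w'
          "turn j' t' / real (2 * j' + b')"]
        frac_bounds[OF turn_bounds[OF t01(1)], of "real b" j]
        frac_bounds[OF turn_bounds[OF t01(2)], of "real b'" j']
        wb(3) wb'(3) off by simp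
    then have "real (2 * j + b) = real (2 * j' + b')"
      using turn turn_pos[OF j(1) t(1)] wb(1) wb'(1) by (auto simp: divide_simps)
    then have "2 * j + b = 2 * j' + b'"
      by (simp only: of_nat_eq_iff)
    \<comment> \<open>As \<open>b\<close> and \<open>b'\<close> are 1 or 2, parity separates them
      from \<open>j\<close> and \<open>j'\<close>.\<close>
    then have "j = j' \<and> b = b'"
      using wb(1) wb'(1) by auto presburger+
    then show ?thesis
      using wb(2) wb'(2) by simp
  next
    case False
    then have "bridge t' \<noteq> 0" "bridge t' \<noteq> 1"
      using page by auto
    then have jj: "j = j'"
      using False turn turn_on_bridge by (metis of_nat_eq_iff)
    let ?a = "real u + turn j t / (2 * real j + 1)" and ?b = "real v + turn j t / (2 * real j + 2)"
    \<comment> \<open>Even for a loop, \<open>u = v\<close>, the two spirals have distinct offsets,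
      since a positive \<open>turn\<close> is divided by different denominators. Interpolating
      between them is therefore injective in \<open>bridge\<close>.\<close>
    have "?a \<noteq> ?b"
    proof
      assume "?a = ?b"
      then have "turn j t / (2 * real j + 1) = turn j t / (2 * real j + 2)"
        using nat_add_frac_inject[of u "turn j t / (2 * real j + 1)" v
            "turn j t / (2 * real j + 2)"]
          frac_bounds[OF turn_bounds[OF t01(1), of j], of 1]
          frac_bounds[OF turn_bounds[OF t01(1), of j], of 2] by simp
      then show False
        using turn_pos[OF j(1) t(1)] by (simp add: divide_simps)
    qed
    moreover have "(1 - bridge t) * ?a + bridge t * ?b = (1 - bridge t') * ?a + bridge t' * ?b"
      using off turn jj same by (simp add: offset_def)
    then have "(bridge t - bridge t') * (?b - ?a) = 0"
      by algebra
    ultimately show ?thesis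
      using jj by simp
  qed
  then show ?thesis
    using turn_bridge_inject turn t01 j by metis
qed

section \<open>The embedding\<close>

theorem corollary5:
  fixes X :: "'a topology" and V :: "'a set" and E :: "'e set"
    and \<phi> :: "'e \<Rightarrow> real \<Rightarrow> 'a"
  assumes "finite_graph X V E \<phi>"
  shows "\<exists>f. embedding_map X book f"
proof -
  have V: "finite V" and E: "finite E"
    and \<phi>V: "\<And>e. e \<in> E \<Longrightarrow> \<phi> e 0 \<in> V" "\<And>e. e \<in> E \<Longrightarrow> \<phi> e 1 \<in> V"
    using assms by (auto simp: finite_graph_def)
  define n where "n = card V"
  define m where "m = card E"
  obtain num :: "'a \<Rightarrow> nat" where num: "bij_betw num V {0..<n}"
    using ex_bij_betw_finite_nat[OF V] n_def by blast
  obtain idx :: "'e \<Rightarrow> nat" where idx: "bij_betw idx E {0..<m}"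
    using ex_bij_betw_finite_nat[OF E] m_def by blast
  have num_less: "num v < n" if "v \<in> V" for v
    using num that by (auto dest: bij_betwE)
  have idx_less: "idx e < m" if "e \<in> E" for e
    using idx that by (auto dest: bij_betwE)
  have num_inj: "inj_on num V" and idx_inj: "inj_on idx E"
    using num idx by (auto simp: bij_betw_def)
  \<comment> \<open>Edge indices run from 1 to \<open>m\<close>, so \<open>n + n * m\<close> bounds
    the modulus of all curves; the extra 1 keeps \<open>R\<close> positive for the empty
    graph.\<close>
  define R where "R = 1 + real n + real n * real m"
  have R: "0 < R"
    by (simp add: R_def add_pos_nonneg)
  \<comment> \<open>The real axis is shrunk onto the spine, centred at 1/2; the imaginary direction
    runs across the flat pages, and the height is kept.\<close>
  define scale :: "complex \<times> real \<Rightarrow> (real \<times> real) \<times> real"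
    where "scale q = ((Im (fst q) / R, snd q), 1 / 2 + Re (fst q) / (2 * R))" for q
  have scale_inject: "scale q = scale q' \<longleftrightarrow> q = q'" for q q'
    using R by (auto simp: scale_def prod_eq_iff complex_eq_iff)
  have scale_book: "scale q \<in> book_coord ` topspace book"
    if "cmod (fst q) \<le> R" "snd q \<in> {0..1}" "Im (fst q) = 0 \<or> snd q = 0" for q
  proof -
    have "\<bar>Im (fst q)\<bar> \<le> R" "\<bar>Re (fst q)\<bar> \<le> R"
      using that(1) abs_Im_le_cmod abs_Re_le_cmod order_trans by blast+
    then show ?thesis
      using that R unfolding scale_def book_coord_image_iff
      by (auto simp: divide_simps abs_le_iff)
  qed
  define p where "p v = scale (of_nat (num v), 0)" for v
  \<comment> \<open>With index 0 the curve would rest at its end vertices on the outer thirds, so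
    \<open>Suc\<close> starts the count at 1.\<close>
  define \<gamma> where "\<gamma> e t =
    scale (edge_curve n (Suc (idx e)) (num (\<phi> e 0)) (num (\<phi> e 1)) t)" for e t
  obtain F where F: "embedding_map X euclidean F"
    "F ` topspace X = p ` V \<union> (\<Union>e\<in>E. \<gamma> e ` {0<..<1})"
  proof (rule embedding_map_finite_graph[OF assms])
    show "inj_on p V"
      using num_inj by (auto simp: p_def scale_inject inj_on_def)
    show "continuous_map (top_of_set {0..1}) euclidean (\<gamma> e)" for e
      unfolding \<gamma>_def scale_def continuous_map_iff_continuous
      using R by (intro continuous_intros continuous_on_edge_curve) auto
    show "e = e' \<and> t = t'"
      if "e \<in> E" "e' \<in> E" "t \<in> {0<..<1}" "t' \<in> {0<..<1}" "\<gamma> e t = \<gamma> e' t'" for e e' t t'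
    proof -
      have idx_eq: "e = e'" if "idx e = idx e'"
        using idx_inj \<open>e \<in> E\<close> \<open>e' \<in> E\<close> that by (auto dest: inj_onD)
      have "Suc (idx e) = Suc (idx e') \<and> t = t'"
      proof (rule edge_curve_inject)
        show "edge_curve n (Suc (idx e)) (num (\<phi> e 0)) (num (\<phi> e 1)) t
            = edge_curve n (Suc (idx e')) (num (\<phi> e' 0)) (num (\<phi> e' 1)) t'"
          using that(5) by (simp add: \<gamma>_def scale_inject)
      qed (use that num_less \<phi>V idx_eq in auto)
      then show ?thesis
        using idx_eq by simp
    qed
    show "\<gamma> e t \<noteq> p v" if "e \<in> E" "t \<in> {0<..<1}" "v \<in> V" for e t v
      using that num_less \<phi>V by (simp add: \<gamma>_def p_def scale_inject edge_curve_avoids_vertices)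
  qed (simp_all add: \<gamma>_def p_def edge_curve_ends)
  have "p v \<in> book_coord ` topspace book" if "v \<in> V" for v
  proof -
    have "real (num v) \<le> R"
      using num_less[OF that] by (simp add: R_def add_nonneg_nonneg add_increasing2)
    then show ?thesis
      unfolding p_def by (intro scale_book) simp_all
  qed
  moreover have "\<gamma> e t \<in> book_coord ` topspace book" if "e \<in> E" "t \<in> {0<..<1}" for e t
    unfolding \<gamma>_def
  proof (intro scale_book edge_curve_pages)
    let ?c = "edge_curve n (Suc (idx e)) (num (\<phi> e 0)) (num (\<phi> e 1)) t"
    have "cmod (fst ?c) \<le> real n + real n * real (Suc (idx e))"
      using that num_less \<phi>V by (intro norm_edge_curve_le) auto
    also have "\<dots> \<le> real n + real n * real m"
      using idx_less[OF that(1)] by (intro add_left_mono mult_left_mono) auto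
    finally show "cmod (fst ?c) \<le> R"
      by (simp add: R_def)
  qed
  ultimately have "F ` topspace X \<subseteq> book_coord ` topspace book"
    unfolding F(2) by blast
  then show ?thesis
    by (rule embedding_map_into_book[OF F(1)])
qed

end
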